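(* Let $N\ge2$, let $W_1\ne W_2$ be bandwidths in $(0,\tfrac12)$ with discrete band-limiting covariances $R_1,R_2$ and commuting Slepian tridiagonals $T_1,T_2$ on $\mathbb{C}^N$, and put $R_0=\operatorname{diag}(R_1,R_2)$, $T_0=\operatorname{diag}(T_1,T_2)$ on $\mathbb{C}^2\otimes\mathbb{C}^N$. Let $(S,\tau)$ be a first-order coupling. Holding the diagonal blocks $R_1,R_2$ fixed, the within-channel part of the second-order commutation equation is $$[R_1,\ddot T_{11}]=-2\,(S\tau^{\top}-\tau S^{\top}),\qquad \ddot T_{11}\ \text{symmetric tridiagonal},$$ and likewise for channel $2$ with $R_2$, $\ddot T_{22}$ and $S^{\top}\tau-\tau^{\top}S$. The map $\ddot T_{11}\mapsto[R_1,\ddot T_{11}]$ on the real symmetric tridiagonal matrices has kernel exactly $\operatorname{span}\{\mathbf{I},T_1\}$, so its image has dimension $2N-3$ and its cokernel, inside the antisymmetric matrices, has dimension $\binom N2-(2N-3)$. A first-order coupling extends to second order if and only if $S\tau^{\top}-\tau S^{\top}$ and $S^{\top}\tau-\tau^{\top}S$ project to zero on these two cokernels (i.e. lie in the images of $X\mapsto[R_1,X]$ and $X\mapsto[R_2,X]$, respectively, on the symmetric tridiagonal matrices).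
   Context: $[X,Y]=XY-YX$; $E_{ij}$ are the $2\times2$ matrix units. For bandwidth $W$, the band-limiting covariance is the $N\times N$ matrix with $R_{mn}=\frac{\sin(2\pi W(m-n))}{\pi(m-n)}$ for $m\ne n$, $R_{nn}=2W$, and Slepian's tridiagonal is the symmetric matrix with $T_{nn}=\bigl(\tfrac{N-1-2n}{2}\bigr)^2\cos(2\pi W)$, $T_{n,n+1}=T_{n+1,n}=\tfrac12(n+1)(N-1-n)$, indices $0,\dots,N-1$; the facts that $[R_i,T_i]=0$ and that $R_i$ has simple spectrum are classical (Slepian). A first-order coupling is a pair of real $N\times N$ matrices $(S,\tau)$, $\tau$ tridiagonal, such that $\dot R=E_{12}\otimes S+E_{21}\otimes S^\top$, $\dot T=E_{12}\otimes\tau+E_{21}\otimes\tau^\top$ satisfy $[\dot R,T_0]+[R_0,\dot T]=0$. It extends to second order (with diagonal blocks of $R$ held fixed) if there exist real symmetric $\ddot R,\ddot T$ on $\mathbb{C}^2\otimes\mathbb{C}^N$, with $\ddot R_{11}=\ddot R_{22}=0$ and all $N\times N$ blocks of $\ddot T$ tridiagonal, such that $[\ddot R,T_0]+2[\dot R,\dot T]+[R_0,\ddot T]=0$. The within-channel part is the $(1,1)$ and $(2,2)$ blocks of this equation. *)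

theory Defs
  imports "HOL-Analysis.Analysis"
begin

type_synonym 'n sqmat = "real ^ 'n ^ 'n"

text \<open>An \<open>N \<times> N\<close> matrix is a \<^typ>\<open>'n sqmat\<close> over a finite linearly ordered index type with
  \<open>N = CARD('n)\<close>. The numerical index \<open>0, \<dots>, N - 1\<close> of a row or column is its rank in that order.\<close>

definition idx :: "'n::{finite,linorder} \<Rightarrow> nat" where
  "idx i = card {j. j < i}"

definition commutator :: "'m::finite sqmat \<Rightarrow> 'm sqmat \<Rightarrow> 'm sqmat" where
  "commutator X Y = X ** Y - Y ** X"

definition symmetric_mat :: "'m::finite sqmat \<Rightarrow> bool" where
  "symmetric_mat A \<longleftrightarrow> transpose A = A"

definition antisymmetric_mats :: "('m::finite sqmat) set" where
  "antisymmetric_mats = {A. transpose A = - A}"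

definition tridiagonal :: "'n::{finite,linorder} sqmat \<Rightarrow> bool" where
  "tridiagonal A \<longleftrightarrow> (\<forall>i j. idx i + 1 < idx j \<or> idx j + 1 < idx i \<longrightarrow> A $ i $ j = 0)"

definition sym_tridiagonals :: "('n::{finite,linorder} sqmat) set" where
  "sym_tridiagonals = {A. symmetric_mat A \<and> tridiagonal A}"

definition band_cov :: "real \<Rightarrow> 'n::{finite,linorder} sqmat" where
  "band_cov W = (\<chi> m n. if m = n then 2 * W
     else sin (2 * pi * W * (real (idx m) - real (idx n))) / (pi * (real (idx m) - real (idx n))))"

definition slepian :: "real \<Rightarrow> 'n::{finite,linorder} sqmat" where
  "slepian W = (\<chi> m n.
     if m = n then ((real CARD('n) - 1 - 2 * real (idx n)) / 2)\<^sup>2 * cos (2 * pi * W)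
     else if idx n = idx m + 1 then 1/2 * (real (idx m) + 1) * (real CARD('n) - 1 - real (idx m))
     else if idx m = idx n + 1 then 1/2 * (real (idx n) + 1) * (real CARD('n) - 1 - real (idx n))
     else 0)"

text \<open>The space \<open>\<complex>\<^sup>2 \<otimes> \<complex>\<^sup>N\<close> is indexed by \<^typ>\<open>2 \<times> 'n\<close>. In the type \<^typ>\<open>2\<close> the two channels are
  \<open>1\<close> and \<open>2\<close> (the latter being equal to \<open>0\<close>). All matrices involved have real entries.\<close>

definition mat_unit :: "'m::finite \<Rightarrow> 'm \<Rightarrow> 'm sqmat" where
  "mat_unit a b = (\<chi> i j. if i = a \<and> j = b then 1 else 0)"

definition kron :: "'a::finite sqmat \<Rightarrow> 'b::finite sqmat \<Rightarrow> ('a \<times> 'b) sqmat" where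
  "kron A B = (\<chi> p q. A $ fst p $ fst q * B $ snd p $ snd q)"

definition block :: "'a::finite \<Rightarrow> 'a \<Rightarrow> ('a \<times> 'b::finite) sqmat \<Rightarrow> 'b sqmat" where
  "block a b M = (\<chi> i j. M $ (a, i) $ (b, j))"

definition diag2 :: "'n::finite sqmat \<Rightarrow> 'n sqmat \<Rightarrow> (2 \<times> 'n) sqmat" where
  "diag2 A B = kron (mat_unit 1 1) A + kron (mat_unit 2 2) B"

definition offdiag2 :: "'n::finite sqmat \<Rightarrow> (2 \<times> 'n) sqmat" where
  "offdiag2 S = kron (mat_unit 1 2) S + kron (mat_unit 2 1) (transpose S)"

definition first_order_coupling ::
  "(2 \<times> 'n::{finite,linorder}) sqmat \<Rightarrow> (2 \<times> 'n) sqmat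
    \<Rightarrow> 'n sqmat \<Rightarrow> 'n sqmat \<Rightarrow> bool" where
  "first_order_coupling R0 T0 S \<tau> \<longleftrightarrow> tridiagonal \<tau> \<and>
     commutator (offdiag2 S) T0 + commutator R0 (offdiag2 \<tau>) = 0"

definition second_order_admissible ::
  "(2 \<times> 'n::{finite,linorder}) sqmat \<Rightarrow> (2 \<times> 'n) sqmat \<Rightarrow> bool" where
  "second_order_admissible Rdd Tdd \<longleftrightarrow>
     symmetric_mat Rdd \<and> symmetric_mat Tdd \<and>
     block 1 1 Rdd = 0 \<and> block 2 2 Rdd = 0 \<and>
     (\<forall>a b. tridiagonal (block a b Tdd))"

definition second_order_lhs ::
  "(2 \<times> 'n::finite) sqmat \<Rightarrow> (2 \<times> 'n) sqmat \<Rightarrow> 'n sqmat \<Rightarrow> 'n sqmat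
    \<Rightarrow> (2 \<times> 'n) sqmat \<Rightarrow> (2 \<times> 'n) sqmat \<Rightarrow> (2 \<times> 'n) sqmat" where
  "second_order_lhs R0 T0 S \<tau> Rdd Tdd =
     commutator Rdd T0 + 2 *\<^sub>R commutator (offdiag2 S) (offdiag2 \<tau>) + commutator R0 Tdd"

definition extends_to_second_order ::
  "(2 \<times> 'n::{finite,linorder}) sqmat \<Rightarrow> (2 \<times> 'n) sqmat
    \<Rightarrow> 'n sqmat \<Rightarrow> 'n sqmat \<Rightarrow> bool" where
  "extends_to_second_order R0 T0 S \<tau> \<longleftrightarrow>
     (\<exists>Rdd Tdd. second_order_admissible Rdd Tdd \<and> second_order_lhs R0 T0 S \<tau> Rdd Tdd = 0)"

definition comm_image :: "'n::{finite,linorder} sqmat \<Rightarrow> 'n sqmat set" where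
  "comm_image R = commutator R ` sym_tridiagonals"

text \<open>For subspaces \<open>U \<subseteq> V\<close>, \<open>quot_proj V U v\<close> is the class of \<open>v \<in> V\<close> in the quotient \<open>V / U\<close>.
  The quotient has dimension \<open>d\<close> when the classes of some \<open>d\<close> vectors form a basis of it: every
  class is the class of a unique linear combination of these vectors.\<close>

definition quot_proj :: "'v::real_vector set \<Rightarrow> 'v set \<Rightarrow> 'v \<Rightarrow> 'v set" where
  "quot_proj V U v = {w \<in> V. w - v \<in> U}"

definition has_quotient_dim :: "'v::real_vector set \<Rightarrow> 'v set \<Rightarrow> nat \<Rightarrow> bool" where
  "has_quotient_dim V U d \<longleftrightarrow>
     (\<exists>B. finite B \<and> B \<subseteq> V \<and> card B = d \<and>
       (\<forall>v\<in>V. \<exists>!c. (\<forall>b. b \<notin> B \<longrightarrow> c b = 0) \<and>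
          quot_proj V U v = quot_proj V U (\<Sum>b\<in>B. c b *\<^sub>R b)))"

end

theory Submission
  imports Defs
begin

text \<open>The kernel is computed without the simplicity of the spectrum of the band-limiting matrix \<open>R\<close>.
  For \<open>X\<close> symmetric tridiagonal with diagonal \<open>a\<close> and off-diagonal entries
  \<open>b\<^sub>k = X\<^sub>k\<^sub>-\<^sub>1\<^sub>,\<^sub>k\<close>, \<open>b\<^sub>0 = b\<^sub>N = 0\<close>, the first subdiagonal of \<open>[R, X] = 0\<close> expresses the differences
  of \<open>a\<close> through \<open>b\<close>; inserting this in the second subdiagonal leaves, after division by
  \<open>sin\<^sup>2 (2\<pi>W)\<close>, the vanishing of the third difference of \<open>b\<close>. So \<open>b\<close> is quadratic in \<open>k\<close> with zeros
  \<open>0\<close> and \<open>N\<close>, that is, a multiple of the off-diagonal \<open>k(N - k)/2\<close> of the Slepian matrix, and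
  subtracting this multiple leaves a scalar matrix. The dimensions follow by rank-nullity. In the
  second-order equation the product of the two off-diagonal first-order terms only enters the
  diagonal blocks, so that the off-diagonal blocks of the second-order terms can be taken to be zero.\<close>

subsection \<open>Quotients and dimensions\<close>

text \<open>A vector of V lies in its own class, which gives one direction. For the other,
  membership in a class is unchanged when the representative moves by an element of U.\<close>

lemma quot_proj_eq_iff:
  assumes U: "subspace U" and v: "v \<in> V"
  shows "quot_proj V U v = quot_proj V U w \<longleftrightarrow> v - w \<in> U"
proof
  assume "quot_proj V U v = quot_proj V U w"
  moreover have "v \<in> quot_proj V U v" using v subspace_0[OF U] by (simp add: quot_proj_def)
  ultimately show "v - w \<in> U" by (simp add: quot_proj_def)
next
  assume vw: "v - w \<in> U"
  have "x - v \<in> U \<longleftrightarrow> x - w \<in> U" for x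
    using subspace_add[OF U _ vw, of "x - v"] subspace_diff[OF U _ vw, of "x - w"]
    by auto
  then show "quot_proj V U v = quot_proj V U w" by (simp add: quot_proj_def)
qed

text \<open>A basis \<open>C\<close> of U is extended to a basis \<open>D\<close> of V. The added
  vectors \<open>D - C\<close> then represent a basis of the quotient, and there are
  \<open>dim V - dim U\<close> of them.\<close>

lemma has_quotient_dim_subspace:
  fixes U V :: "'v::euclidean_space set"
  assumes U: "subspace U" and V: "subspace V" and "U \<subseteq> V"
  shows "has_quotient_dim V U (dim V - dim U)"
proof -
  obtain C where C: "C \<subseteq> U" "independent C" "U \<subseteq> span C" "card C = dim U"
    using basis_exists by blast
  have "C \<subseteq> V" using C(1) \<open>U \<subseteq> V\<close> by (rule order_trans)
  then obtain D where D: "C \<subseteq> D" "D \<subseteq> V" "independent D" "V \<subseteq> span D"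
    using C(2) by (rule maximal_independent_subset_extend)
  have fin: "finite D" "finite C"
    using D(3) C(2) by (simp_all add: independent_imp_finite)
  have "card D = dim V"
    using D by (metis basis_card_eq_dim)
  have UC: "span C = U" using C U by (meson span_minimal subset_antisym)
  define B where "B = D - C"
  have finB: "finite B" and BV: "B \<subseteq> V" and "B \<subseteq> D"
    using fin D by (auto simp: B_def)
  have card: "card B = dim V - dim U"
    using fin D \<open>card D = dim V\<close> C by (simp add: B_def card_Diff_subset)
  note quot = quot_proj_eq_iff[OF U]
  have sumV: "(\<Sum>b\<in>B. c b *\<^sub>R b) \<in> V" for c
    using BV V by (intro subspace_sum subspace_mul) auto
  \<comment> \<open>The coordinates of such an x with respect to \<open>D\<close> are supported both
    in \<open>B\<close> and in \<open>C\<close>, which are disjoint, so they all vanish.\<close>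
  have disj: "x = 0" if "x \<in> span B" "x \<in> span C" for x
  proof -
    have rep: "representation B x = representation D x" "representation C x = representation D x"
      using representation_extend[OF D(3) that(1) \<open>B \<subseteq> D\<close>]
        representation_extend[OF D(3) that(2) D(1)] by simp_all
    have "representation D x b = 0" for b
      using representation_ne_zero[of B x b] representation_ne_zero[of C x b]
      unfolding rep by (auto simp: B_def)
    moreover have "x \<in> span D" using that(2) span_mono[OF D(1)] by blast
    ultimately show ?thesis
      using sum_nonzero_representation_eq[OF D(3), of x] by simp
  qed
  have "\<exists>!c. (\<forall>b. b \<notin> B \<longrightarrow> c b = 0) \<and>
          quot_proj V U v = quot_proj V U (\<Sum>b\<in>B. c b *\<^sub>R b)" if v: "v \<in> V" for v
  proof (rule ex_ex1I)
    have "v \<in> span (B \<union> C)"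
      using v D by (auto simp: B_def Un_absorb2)
    then obtain x y where xy: "v = x + y" "x \<in> span B" "y \<in> span C"
      by (auto simp: span_Un)
    then obtain c where c: "x = (\<Sum>b\<in>B. c b *\<^sub>R b)"
      using span_finite[OF finB] by auto
    \<comment> \<open>Uniqueness of coefficient functions is meant among those that vanish off
      \<open>B\<close>, so the coefficients are cut off there.\<close>
    define c' where "c' b = (if b \<in> B then c b else 0)" for b
    have c': "x = (\<Sum>b\<in>B. c' b *\<^sub>R b)" unfolding c by (rule sum.cong) (auto simp: c'_def)
    have "v - x \<in> U" using xy UC by auto
    then have "quot_proj V U v = quot_proj V U x"
      using quot[OF v, of x] sumV[of c'] c' by simp
    then show "\<exists>c. (\<forall>b. b \<notin> B \<longrightarrow> c b = 0) \<and>
          quot_proj V U v = quot_proj V U (\<Sum>b\<in>B. c b *\<^sub>R b)"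
      using c' by (intro exI[of _ c']) (auto simp: c'_def)
  next
    fix c c'
    assume c: "(\<forall>b. b \<notin> B \<longrightarrow> c b = 0) \<and> quot_proj V U v = quot_proj V U (\<Sum>b\<in>B. c b *\<^sub>R b)"
      and c': "(\<forall>b. b \<notin> B \<longrightarrow> c' b = 0) \<and> quot_proj V U v = quot_proj V U (\<Sum>b\<in>B. c' b *\<^sub>R b)"
    then have "quot_proj V U (\<Sum>b\<in>B. c b *\<^sub>R b) = quot_proj V U (\<Sum>b\<in>B. c' b *\<^sub>R b)"
      by metis
    then have "(\<Sum>b\<in>B. c b *\<^sub>R b) - (\<Sum>b\<in>B. c' b *\<^sub>R b) \<in> U"
      using quot[OF sumV] by blast
    then have U': "(\<Sum>b\<in>B. (c b - c' b) *\<^sub>R b) \<in> span C"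
      by (simp add: UC sum_subtractf scaleR_left_diff_distrib)
    have "(\<Sum>b\<in>B. (c b - c' b) *\<^sub>R b) \<in> span B"
      by (intro span_sum span_scale span_base)
    with U' disj have "(\<Sum>b\<in>B. (c b - c' b) *\<^sub>R b) = 0" by blast
    moreover have "independent B" using D(3) \<open>B \<subseteq> D\<close> independent_mono by blast
    ultimately have "c b - c' b = 0" if "b \<in> B" for b
      using independentD[of B B "\<lambda>b. c b - c' b" b] finB that by blast
    then show "c = c'" using c c' by (intro ext) (metis eq_iff_diff_eq_0)
  qed
  then show ?thesis
    unfolding has_quotient_dim_def by (intro exI[of _ B] conjI finB BV card ballI)
qed

section \<open>Matrices with prescribed support\<close>

definition support_mats :: "('n \<times> 'n) set \<Rightarrow> ('n::finite) sqmat set" where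
  "support_mats P = {X. \<forall>i j. (i, j) \<notin> P \<longrightarrow> X $ i $ j = 0}"

lemma subspace_support_mats: "subspace (support_mats P)"
  by (auto simp: support_mats_def subspace_def)

text \<open>The matrix units at positions in \<open>P\<close> are standard basis vectors, so this is
  a coordinate subspace. It reduces the dimensions below to counting index pairs.\<close>

lemma dim_support_mats: "dim (support_mats P) = card P"
proof -
  define d :: "'a sqmat set" where "d = (\<lambda>(i, j). axis i (axis j 1)) ` P"
  have inj: "inj (\<lambda>(i, j). axis i (axis j 1) :: 'a sqmat)"
    by (auto simp: inj_def axis_eq_axis)
  have mem: "axis i (axis j 1) \<in> d \<longleftrightarrow> (i, j) \<in> P" for i j :: 'a
    unfolding d_def using inj_image_mem_iff[OF inj, of "(i, j)" P] by simp
  have "d \<subseteq> Basis" by (auto simp: d_def Basis_vec_def)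
  moreover have "support_mats P = {x. \<forall>i\<in>Basis. i \<notin> d \<longrightarrow> x \<bullet> i = 0}"
    by (auto simp: support_mats_def Basis_vec_def inner_axis mem)
  moreover have "card d = card P"
    unfolding d_def using inj by (simp add: card_image inj_on_subset)
  ultimately show ?thesis using dim_substandard[of d] by simp
qed

lemma transpose_zero [simp]: "transpose (0 :: real^'n^'m) = 0"
  by (simp add: transpose_def vec_eq_iff)

lemma transpose_add: "transpose (A + B) = transpose A + transpose (B :: real^'n^'m)"
  and transpose_diff: "transpose (A - B) = transpose A - transpose (B :: real^'n^'m)"
  by (simp_all add: transpose_def vec_eq_iff)

section \<open>Ranks of indices and counting of index pairs\<close>

lemma strict_mono_idx: "strict_mono (idx :: 'n::{finite,linorder} \<Rightarrow> nat)"
proof (rule strict_monoI)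
  fix i j :: 'n assume "i < j"
  then have "{k. k < i} \<subset> {k. k < j}" by auto
  then show "idx i < idx j" unfolding idx_def by (intro psubset_card_mono) auto
qed

lemma idx_less_CARD: "idx (i :: 'n::{finite,linorder}) < CARD('n)"
  unfolding idx_def by (intro psubset_card_mono) auto

lemma bij_betw_idx: "bij_betw (idx :: 'n::{finite,linorder} \<Rightarrow> nat) UNIV {..<CARD('n)}"
proof -
  have inj: "inj (idx :: 'n \<Rightarrow> nat)" using strict_mono_idx by (rule strict_mono_imp_inj_on)
  have "range (idx :: 'n \<Rightarrow> nat) = {..<CARD('n)}"
    using inj idx_less_CARD by (intro card_subset_eq) (auto simp: card_image)
  then show ?thesis using inj by (simp add: bij_betw_def)
qed

lemma idx_eq_iff [simp]: "idx i = idx j \<longleftrightarrow> i = (j :: 'n::{finite,linorder})"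
  by (rule strict_mono_eq[OF strict_mono_idx])

lemma idx_less_iff [simp]: "idx i < idx j \<longleftrightarrow> i < (j :: 'n::{finite,linorder})"
  by (rule strict_mono_less[OF strict_mono_idx])

definition nth_index :: "nat \<Rightarrow> 'n::{finite,linorder}" where
  "nth_index = inv_into UNIV idx"

lemma nth_index_idx [simp]: "nth_index (idx i) = i"
  unfolding nth_index_def using bij_betw_idx by (metis bij_betw_inv_into_left UNIV_I)

lemma idx_nth_index [simp]: "k < CARD('n) \<Longrightarrow> idx (nth_index k :: 'n::{finite,linorder}) = k"
  unfolding nth_index_def using bij_betw_idx by (metis bij_betw_inv_into_right lessThan_iff)

lemma card_index_pairs:
  "card {(i :: 'n::{finite,linorder}, j :: 'n). Q (idx i) (idx j)}
     = card {(a, b). a < CARD('n) \<and> b < CARD('n) \<and> Q a b}"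
proof (rule bij_betw_same_card)
  show "bij_betw (map_prod idx idx) {(i :: 'n, j :: 'n). Q (idx i) (idx j)}
      {(a, b). a < CARD('n) \<and> b < CARD('n) \<and> Q a b}"
    by (rule bij_betwI[where g = "map_prod nth_index nth_index"]) (auto simp: idx_less_CARD)
qed

lemma card_less_pairs: "card {(a, b). a < n \<and> b < n \<and> a < b} = n choose 2"
proof -
  have "{(a, b). a < n \<and> b < n \<and> a < b} = (SIGMA a:{..<n}. {a<..<n})" by auto
  then have "card {(a, b). a < n \<and> b < n \<and> a < b} = (\<Sum>a<n. n - Suc a)"
    by simp
  also have "\<dots> = (\<Sum>a<n. a)" by (rule sum.nat_diff_reindex)
  also have "\<dots> = n choose 2"
    by (induction n) (auto simp: numeral_2_eq_2)
  finally show ?thesis .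
qed

lemma card_neighbour_pairs:
  assumes "n \<ge> 1"
  shows "card {(a, b). a < n \<and> b < n \<and> (b = a \<or> b = Suc a)} = 2 * n - 1"
proof -
  have eq: "{(a, b). a < n \<and> b < n \<and> (b = a \<or> b = Suc a)}
      = (\<lambda>a. (a, a)) ` {..<n} \<union> (\<lambda>a. (a, Suc a)) ` {..<n - 1}"
    by auto
  show ?thesis
    unfolding eq using assms
    by (subst card_Un_disjoint) (auto simp: card_image inj_on_def)
qed

section \<open>Dimensions of the antisymmetric and the symmetric tridiagonal matrices\<close>

lemma subspace_antisymmetric_mats: "subspace antisymmetric_mats"
  by (simp add: subspace_def antisymmetric_mats_def transpose_add transpose_scalar)

text \<open>The map X - X^T carries the strictly upper triangular matrices bijectively onto the
  antisymmetric ones: no nonzero entry of such an X meets its own mirror image.\<close>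

lemma dim_antisymmetric_mats:
  "dim (antisymmetric_mats :: 'n::{finite,linorder} sqmat set) = CARD('n) choose 2"
proof -
  define P where "P = {(i :: 'n, j :: 'n). idx i < idx j}"
  define f :: "'n sqmat \<Rightarrow> 'n sqmat" where "f X = X - transpose X" for X
  have lin: "linear f"
    by (intro linearI) (simp_all add: f_def transpose_add transpose_scalar scaleR_right_diff_distrib)
  have "f ` support_mats P = antisymmetric_mats"
  proof (intro equalityI subsetI)
    fix A :: "'n sqmat" assume "A \<in> antisymmetric_mats"
    then have A': "transpose A = - A" by (simp add: antisymmetric_mats_def)
    have A: "A $ j $ i = - A $ i $ j" for i j
      using arg_cong[OF A', of "\<lambda>B. B $ i $ j"] by (simp add: transpose_def)
    have A0: "A $ i $ i = 0" for i using A[of i i] by linarith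
    define X :: "'n sqmat" where "X = (\<chi> i j. if i < j then A $ i $ j else 0)"
    have "X \<in> support_mats P" by (simp add: X_def support_mats_def P_def)
    moreover have "f X = A"
      unfolding vec_eq_iff
    proof (intro allI)
      fix i j
      show "f X $ i $ j = A $ i $ j"
        using A[of i j] A0[of i]
        by (cases i j rule: linorder_cases) (auto simp: f_def X_def transpose_def)
    qed
    ultimately show "A \<in> f ` support_mats P" by blast
  qed (auto simp: f_def antisymmetric_mats_def transpose_diff)
  moreover have "inj_on f (support_mats P)"
  proof (subst linear_inj_on_iff_eq_0[OF lin subspace_support_mats], intro ballI impI)
    fix X assume X: "X \<in> support_mats P" and "f X = 0"
    then have "X $ i $ j = X $ j $ i" for i j
      by (simp add: f_def transpose_def vec_eq_iff)
    moreover have "X $ i $ j = 0 \<or> X $ j $ i = 0" for i j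
    proof -
      have "(i, j) \<notin> P \<or> (j, i) \<notin> P" by (auto simp: P_def)
      then show ?thesis using X by (auto simp: support_mats_def)
    qed
    ultimately show "X = 0" unfolding vec_eq_iff by (metis zero_index)
  qed
  ultimately have "dim (antisymmetric_mats :: 'n sqmat set) = dim (support_mats P)"
    using dim_image_eq[OF lin, of "support_mats P"] subspace_support_mats[of P]
    by (simp add: span_eq_iff[THEN iffD2])
  then show ?thesis
    by (simp add: dim_support_mats P_def card_index_pairs[of "(<)"] card_less_pairs del: idx_less_iff)
qed

lemma subspace_sym_tridiagonals: "subspace sym_tridiagonals"
  by (auto simp: subspace_def sym_tridiagonals_def symmetric_mat_def tridiagonal_def
      transpose_add transpose_scalar)

text \<open>The map X + X^T carries the upper bidiagonal matrices bijectively onto the symmetric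
  tridiagonal ones, so the dimension is N + (N - 1).\<close>

lemma dim_sym_tridiagonals:
  "dim (sym_tridiagonals :: 'n::{finite,linorder} sqmat set) = 2 * CARD('n) - 1"
proof -
  define P where "P = {(i :: 'n, j :: 'n). idx j = idx i \<or> idx j = Suc (idx i)}"
  define f :: "'n sqmat \<Rightarrow> 'n sqmat" where "f X = X + transpose X" for X
  have lin: "linear f"
    by (intro linearI) (simp_all add: f_def transpose_add transpose_scalar scaleR_right_distrib)
  have "f ` support_mats P = sym_tridiagonals"
  proof (intro equalityI subsetI)
    fix A :: "'n sqmat" assume "A \<in> sym_tridiagonals"
    then have A: "A $ j $ i = A $ i $ j" and tri: "idx i + 1 < idx j \<Longrightarrow> A $ i $ j = 0" for i j
      by (auto simp: sym_tridiagonals_def symmetric_mat_def tridiagonal_def transpose_def vec_eq_iff)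
    have near: "idx i = idx j \<or> idx j = Suc (idx i) \<or> idx i = Suc (idx j) \<or> A $ i $ j = 0" for i j
      using tri[of i j] tri[of j i] A[of i j] by linarith
    \<comment> \<open>The diagonal is halved because X + X^T doubles it.\<close>
    define X :: "'n sqmat" where
      "X = (\<chi> i j. if i = j then A $ i $ j / 2 else if idx j = Suc (idx i) then A $ i $ j else 0)"
    have "X \<in> support_mats P" by (auto simp: X_def support_mats_def P_def)
    moreover have "f X = A"
      unfolding vec_eq_iff
    proof (intro allI)
      fix i j
      show "f X $ i $ j = A $ i $ j"
        using near[of i j] A[of i j] idx_eq_iff[of i j] by (auto simp: f_def X_def transpose_def)
    qed
    ultimately show "A \<in> f ` support_mats P" by blast
  next
    fix A assume "A \<in> f ` support_mats P"
    then obtain X where X: "X \<in> support_mats P" and A: "A = X + transpose X"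
      by (auto simp: f_def)
    have "X $ i $ j = 0" "X $ j $ i = 0" if "idx i + 1 < idx j \<or> idx j + 1 < idx i" for i j
      using X that by (auto simp: support_mats_def P_def simp del: idx_eq_iff)
    then show "A \<in> sym_tridiagonals"
      by (auto simp: A sym_tridiagonals_def symmetric_mat_def tridiagonal_def transpose_def vec_eq_iff)
  qed
  moreover have "inj_on f (support_mats P)"
  proof (subst linear_inj_on_iff_eq_0[OF lin subspace_support_mats], intro ballI impI)
    fix X assume X: "X \<in> support_mats P" and "f X = 0"
    then have "X $ i $ j = - X $ j $ i" for i j
      by (simp add: f_def transpose_def vec_eq_iff eq_neg_iff_add_eq_0)
    moreover have "X $ i $ j = 0 \<or> X $ j $ i = 0 \<or> i = j" for i j
    proof -
      have "(i, j) \<notin> P \<or> (j, i) \<notin> P \<or> i = j" by (auto simp: P_def)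
      then show ?thesis using X by (auto simp: support_mats_def)
    qed
    ultimately show "X = 0" unfolding vec_eq_iff
      by (metis zero_index neg_equal_zero neg_equal_0_iff_equal)
  qed
  ultimately have "dim (sym_tridiagonals :: 'n sqmat set) = dim (support_mats P)"
    using dim_image_eq[OF lin, of "support_mats P"] subspace_support_mats[of P]
    by (simp add: span_eq_iff[THEN iffD2])
  then show ?thesis
    by (simp add: dim_support_mats P_def card_index_pairs[of "\<lambda>a b. b = a \<or> b = Suc a"]
        card_neighbour_pairs del: idx_eq_iff)
qed

text \<open>Rank-nullity on a subspace. The orthogonal complement \<open>C\<close> of the kernel
  within V meets the kernel only in 0, so f is injective on it; dropping the kernel component of a
  vector does not change its value, so \<open>C\<close> has the same image as V.\<close>

lemma dim_linear_image_kernel: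
  fixes f :: "'v::euclidean_space \<Rightarrow> 'w::euclidean_space"
  assumes f: "linear f" and V: "subspace V"
  shows "dim (f ` V) + dim {x \<in> V. f x = 0} = dim V"
proof -
  define K where "K = {x \<in> V. f x = 0}"
  define C where "C = {y \<in> V. \<forall>x\<in>K. orthogonal x y}"
  have K: "subspace K" unfolding K_def
    using V by (auto simp: subspace_def linear_0[OF f] linear_add[OF f] linear_scale[OF f])
  have C: "subspace C" unfolding C_def using V
    by (auto simp: subspace_def orthogonal_def inner_add_right)
  have KC: "dim C + dim K = dim V"
    unfolding C_def by (rule dim_subspace_orthogonal_to_vectors[OF K V]) (simp add: K_def)
  have "inj_on f C"
    by (subst linear_inj_on_iff_eq_0[OF f C]) (auto simp: C_def K_def orthogonal_def)
  then have "dim (f ` C) = dim C"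
    using dim_image_eq[OF f] C by (simp add: span_eq_iff[THEN iffD2])
  moreover have "f ` C = f ` V"
  proof
    show "f ` V \<subseteq> f ` C"
    proof
      fix w assume "w \<in> f ` V"
      then obtain v where v: "v \<in> V" "w = f v" by blast
      obtain y z where yz: "y \<in> span K" "\<And>u. u \<in> span K \<Longrightarrow> orthogonal z u" "v = y + z"
        using orthogonal_subspace_decomp_exists[of K v] by blast
      have "y \<in> K" using yz K by (simp add: span_eq_iff[THEN iffD2])
      have "z \<in> V" using yz \<open>y \<in> K\<close> v V unfolding K_def by (metis (no_types, lifting) add_diff_cancel_left' mem_Collect_eq subspace_diff)
      then have "z \<in> C" using yz(2) by (auto simp: C_def span_base orthogonal_commute)
      moreover have "f z = w" using yz v \<open>y \<in> K\<close> by (simp add: linear_add[OF f] K_def)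
      ultimately show "w \<in> f ` C" by blast
    qed
  qed (auto simp: C_def)
  ultimately show ?thesis using KC by (simp add: K_def)
qed

subsection \<open>Commutators with the band-limiting covariance\<close>

definition diag_entry :: "'n::{finite,linorder} sqmat \<Rightarrow> nat \<Rightarrow> real" where
  "diag_entry X k = X $ nth_index k $ nth_index k"

text \<open>The guard supplies the value 0 just outside both ends of the off-diagonal. Entry
  formulas then need no boundary cases, and the two zeros at 0 and N are the boundary conditions in
  the kernel computation.\<close>

definition sub_entry :: "'n::{finite,linorder} sqmat \<Rightarrow> nat \<Rightarrow> real" where
  "sub_entry X k = (if 0 < k \<and> k < CARD('n) then X $ nth_index (k - 1) $ nth_index k else 0)"

lemma sub_entry_boundary [simp]:
  "sub_entry X 0 = 0" "sub_entry (X :: 'n::{finite,linorder} sqmat) CARD('n) = 0"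
  by (simp_all add: sub_entry_def)

text \<open>All conditions are phrased through ranks, so that sums over the index type can be
  transported to sums over natural numbers.\<close>

lemma sym_tridiagonal_entry:
  fixes X :: "'n::{finite,linorder} sqmat"
  assumes X: "X \<in> sym_tridiagonals"
  shows "X $ i $ j = (if idx i = idx j then diag_entry X (idx j)
     else if Suc (idx i) = idx j then sub_entry X (idx j)
     else if idx i = Suc (idx j) then sub_entry X (idx i) else 0)"
proof -
  have sym: "X $ i $ j = X $ j $ i" for i j
    using X by (auto simp: sym_tridiagonals_def symmetric_mat_def transpose_def vec_eq_iff)
  have tri: "X $ i $ j = 0" if "idx i + 1 < idx j \<or> idx j + 1 < idx i"
    using X that by (auto simp: sym_tridiagonals_def tridiagonal_def)
  consider "idx i = idx j" | "Suc (idx i) = idx j" | "idx i = Suc (idx j)"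
    | "idx i + 1 < idx j \<or> idx j + 1 < idx i"
    by linarith
  then show ?thesis
  proof cases
    case 2
    then have "nth_index (idx j - 1) = i" by (metis diff_Suc_1 nth_index_idx)
    with 2 show ?thesis using idx_less_CARD[of j] by (auto simp: sub_entry_def simp del: idx_eq_iff)
  next
    case 3
    then have "nth_index (idx i - 1) = j" by (metis diff_Suc_1 nth_index_idx)
    moreover have "nth_index (Suc (idx j)) = i" using 3 by (metis nth_index_idx)
    ultimately show ?thesis using 3 sym[of i j] idx_less_CARD[of i] by (auto simp: sub_entry_def simp del: idx_eq_iff)
  qed (use tri in \<open>auto simp: diag_entry_def simp del: idx_eq_iff\<close>, simp)
qed

lemma sum_over_index:
  "(\<Sum>k\<in>UNIV. g (idx (k :: 'n::{finite,linorder}))) = (\<Sum>k<CARD('n). g k)"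
  using sum.reindex_bij_betw[OF bij_betw_idx[where 'n='n], of g] by simp

text \<open>Column j of X has entries only in rows j - 1, j and j + 1, so at most three terms of the
  sum survive.\<close>

lemma toeplitz_tridiagonal_mult:
  fixes R X :: "'n::{finite,linorder} sqmat"
  assumes R: "\<And>i j. R $ i $ j = r (real (idx i) - real (idx j))"
    and X: "X \<in> sym_tridiagonals"
  shows "(R ** X) $ i $ j = r (real (idx i) - real (idx j)) * diag_entry X (idx j)
     + r (real (idx i) - real (idx j) + 1) * sub_entry X (idx j)
     + r (real (idx i) - real (idx j) - 1) * sub_entry X (Suc (idx j))"
proof -
  define n where "n = idx j"
  have n: "n < CARD('n)" by (simp add: n_def idx_less_CARD)
  define q where "q k = r (real (idx i) - real k)" for k
  have "(R ** X) $ i $ j = (\<Sum>k\<in>UNIV. q (idx k) * (if idx (k :: 'n) = n then diag_entry X n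
     else if Suc (idx k) = n then sub_entry X n
     else if idx k = Suc n then sub_entry X (idx k) else 0))"
    unfolding n_def by (simp add: matrix_matrix_mult_def R q_def sym_tridiagonal_entry[OF X, of _ j] del: idx_eq_iff)
  also have "\<dots> = (\<Sum>k<CARD('n). q k * (if k = n then diag_entry X n
     else if Suc k = n then sub_entry X n
     else if k = Suc n then sub_entry X k else 0))"
    by (rule sum_over_index)
  \<comment> \<open>The condition \<open>n > 0\<close> is essential: for n = 0 the truncated
    \<open>n - 1\<close> is 0 and would pick up a spurious term.\<close>
  also have "\<dots> = (\<Sum>k<CARD('n). (if k = n then q n * diag_entry X n else 0)
     + (if k = n - 1 \<and> n > 0 then q (n - 1) * sub_entry X n else 0)
     + (if k = Suc n then q (Suc n) * sub_entry X (Suc n) else 0))"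
    by (rule sum.cong) auto
  also have "\<dots> = q n * diag_entry X n + (if n > 0 then q (n - 1) * sub_entry X n else 0)
     + (if Suc n < CARD('n) then q (Suc n) * sub_entry X (Suc n) else 0)"
    using n by (cases "n > 0") (simp_all add: sum.distrib)
  \<comment> \<open>At the two ends the missing neighbour has \<open>sub_entry\<close> 0, so both
    case distinctions disappear.\<close>
  also have "\<dots> = q n * diag_entry X n + r (real (idx i) - real n + 1) * sub_entry X n
     + r (real (idx i) - real n - 1) * sub_entry X (Suc n)"
    using n by (auto simp: q_def of_nat_diff algebra_simps sub_entry_def)
  finally show ?thesis by (simp add: q_def n_def)
qed

text \<open>Both factors are symmetric, hence XR is the transpose of RX and the commutator is RX
  minus its transpose. The formula for one product therefore suffices.\<close>

lemma toeplitz_tridiagonal_commutator: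
  fixes R X :: "'n::{finite,linorder} sqmat"
  assumes R: "\<And>i j. R $ i $ j = r (real (idx i) - real (idx j))"
    and even: "\<And>x. r (- x) = r x"
    and X: "X \<in> sym_tridiagonals"
  shows "commutator R X $ i $ j
     = r (real (idx i) - real (idx j)) * (diag_entry X (idx j) - diag_entry X (idx i))
     + r (real (idx i) - real (idx j) + 1) * (sub_entry X (idx j) - sub_entry X (Suc (idx i)))
     + r (real (idx i) - real (idx j) - 1) * (sub_entry X (Suc (idx j)) - sub_entry X (idx i))"
proof -
  have "R = transpose R"
    using even by (simp add: transpose_def vec_eq_iff R) (metis minus_diff_eq)
  moreover have "X = transpose X" using X by (simp add: sym_tridiagonals_def symmetric_mat_def)
  ultimately have "X ** R = transpose (R ** X)" by (metis matrix_transpose_mul)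
  then have "commutator R X $ i $ j = (R ** X) $ i $ j - (R ** X) $ j $ i"
    by (simp add: commutator_def transpose_def)
  moreover have "r (real (idx j) - real (idx i)) = r (real (idx i) - real (idx j))"
    "r (real (idx j) - real (idx i) + 1) = r (real (idx i) - real (idx j) - 1)"
    "r (real (idx j) - real (idx i) - 1) = r (real (idx i) - real (idx j) + 1)"
    using even[of "real (idx i) - real (idx j)"] even[of "real (idx i) - real (idx j) - 1"]
      even[of "real (idx i) - real (idx j) + 1"] by (simp_all add: algebra_simps)
  ultimately show ?thesis
    unfolding toeplitz_tridiagonal_mult[OF R X] by (simp add: algebra_simps)
qed

section \<open>The sine kernel and the Slepian matrix\<close>

definition sinc_kernel :: "real \<Rightarrow> real \<Rightarrow> real" where
  "sinc_kernel W x = (if x = 0 then 2 * W else sin (2 * pi * W * x) / (pi * x))"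

lemma sinc_kernel_minus: "sinc_kernel W (- x) = sinc_kernel W x"
  by (simp add: sinc_kernel_def)

lemma band_cov_entry: "band_cov W $ i $ j = sinc_kernel W (real (idx i) - real (idx j))"
  by (simp add: band_cov_def sinc_kernel_def)

lemmas commutator_band_cov =
  toeplitz_tridiagonal_commutator[of "band_cov W" "sinc_kernel W" for W,
    OF band_cov_entry sinc_kernel_minus]

lemma slepian_sym_tridiagonal: "slepian W \<in> sym_tridiagonals"
  by (auto simp: sym_tridiagonals_def symmetric_mat_def tridiagonal_def slepian_def
      transpose_def vec_eq_iff)

lemma diag_entry_slepian:
  "k < CARD('n) \<Longrightarrow> diag_entry (slepian W :: 'n::{finite,linorder} sqmat) k
     = ((real CARD('n) - 1 - 2 * real k) / 2)\<^sup>2 * cos (2 * pi * W)"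
  by (simp add: diag_entry_def slepian_def)

lemma sub_entry_slepian:
  assumes "k \<le> CARD('n)"
  shows "sub_entry (slepian W :: 'n::{finite,linorder} sqmat) k = real k * (real CARD('n) - real k) / 2"
proof (cases "k = 0 \<or> k = CARD('n)")
  case False
  then have k: "0 < k" "k < CARD('n)" using assms by auto
  then have "idx (nth_index (k - 1) :: 'n) = k - 1" "idx (nth_index k :: 'n) = k" by auto
  moreover from this k have "nth_index (k - 1) \<noteq> (nth_index k :: 'n)" by (metis diff_less zero_less_one less_irrefl)
  ultimately show ?thesis using k
    by (simp add: sub_entry_def slepian_def of_nat_diff)
qed auto

text \<open>In entry (m, n), with d = m - n, each difference of Slepian entries contains the factor
  N - 1 - n - m. What remains is the addition formula sin(td) cos t = (sin(t(d+1)) +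
  sin(t(d-1)))/2.\<close>

lemma commutator_slepian:
  "commutator (band_cov W) (slepian W :: 'n::{finite,linorder} sqmat) = 0"
proof -
  have "commutator (band_cov W) (slepian W :: 'n sqmat) $ i $ j = 0" for i j
  proof -
    define N where "N = real CARD('n)"
    define m n where "m = real (idx i)" and "n = real (idx j)"
    define d where "d = m - n"
    define t where "t = 2 * pi * W"
    have lt: "idx i < CARD('n)" "idx j < CARD('n)" by (simp_all add: idx_less_CARD)
    have "commutator (band_cov W) (slepian W :: 'n sqmat) $ i $ j
       = sinc_kernel W d * (((N - 1 - 2 * n) / 2)\<^sup>2 * cos t - ((N - 1 - 2 * m) / 2)\<^sup>2 * cos t)
       + sinc_kernel W (d + 1) * (n * (N - n) / 2 - (m + 1) * (N - (m + 1)) / 2)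
       + sinc_kernel W (d - 1) * ((n + 1) * (N - (n + 1)) / 2 - m * (N - m) / 2)"
      unfolding commutator_band_cov[OF slepian_sym_tridiagonal]
      using lt by (simp add: diag_entry_slepian sub_entry_slepian N_def m_def n_def t_def d_def add.commute)
    also have "\<dots> = (N - 1 - n - m) * (sinc_kernel W d * d * cos t
        - sinc_kernel W (d + 1) * (d + 1) / 2 - sinc_kernel W (d - 1) * (d - 1) / 2)"
      unfolding d_def by (simp add: power2_eq_square field_simps)
    also have "\<dots> = 0"
    proof -
      \<comment> \<open>Multiplying by x clears the denominator and makes the formula valid at x = 0
        as well, so the cases d = 0, 1, -1 need no separate treatment.\<close>
      have sinc: "sinc_kernel W x * x = sin (t * x) / pi" for x
        by (simp add: sinc_kernel_def t_def)
      have "sin (t * d) * cos t = sin (t * (d + 1)) / 2 + sin (t * (d - 1)) / 2"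
        by (simp add: ring_distribs sin_add sin_diff) (simp add: field_simps)
      then have "sinc_kernel W d * d * cos t
        - sinc_kernel W (d + 1) * (d + 1) / 2 - sinc_kernel W (d - 1) * (d - 1) / 2 = 0"
        unfolding sinc by (simp add: field_simps)
      then show ?thesis by simp
    qed
    finally show ?thesis .
  qed
  then show ?thesis by (simp add: vec_eq_iff)
qed

section \<open>The kernel of the commutator map\<close>

lemma commutator_mat_1: "commutator R (mat 1) = 0"
  by (simp add: commutator_def)

lemma linear_commutator: "linear (commutator R)"
  by (intro linearI)
    (simp_all add: commutator_def matrix_matrix_mult_def vec_eq_iff sum.distrib sum_distrib_left
      sum_subtractf algebra_simps)

text \<open>A vanishing third difference makes b quadratic. The zeros at 0 and 1 leave only
  multiples of k(k - 1)/2, and a further zero at N >= 2 forces the multiple \<open>b 2\<close> to be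
  0.\<close>

lemma third_difference_zero:
  fixes b :: "nat \<Rightarrow> real"
  assumes rec: "\<And>n. n + 3 \<le> N \<Longrightarrow> b (n + 3) - 3 * b (n + 2) + 3 * b (n + 1) - b n = 0"
    and b0: "b 0 = 0" "b 1 = 0" and bN: "b N = 0" and "N \<ge> 2" and "k \<le> N"
  shows "b k = 0"
proof -
  have quad: "b k = real k * (real k - 1) / 2 * b 2" if "k \<le> N" for k
    using that
  proof (induction k rule: less_induct)
    case (less k)
    \<comment> \<open>Since subtraction truncates, \<open>k - 3 + 3\<close> equals k exactly when k
      is at least 3; this supplies the n with k = n + 3.\<close>
    have "k = 0 \<or> k = 1 \<or> k = 2 \<or> k = k - 3 + 3" by linarith
    then consider "k = 0" | "k = 1" | "k = 2" | n where "k = n + 3" by blast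
    then show ?case
    proof cases
      case (4 n)
      have "b k = 3 * b (n + 2) - 3 * b (n + 1) + b n"
        using rec[of n] less.prems 4 by simp
      moreover have "b (n + 2) = real (n + 2) * (real (n + 2) - 1) / 2 * b 2"
        "b (n + 1) = real (n + 1) * (real (n + 1) - 1) / 2 * b 2"
        "b n = real n * (real n - 1) / 2 * b 2"
        using less.prems 4 by (intro less.IH; simp)+
      ultimately show ?thesis by (simp add: 4 field_simps)
    qed (use b0 in auto)
  qed
  have "b 2 = 0" using quad[of N] bN \<open>N \<ge> 2\<close> by auto
  then show ?thesis using quad \<open>k \<le> N\<close> by simp
qed

text \<open>This is the normalised case left after a Slepian multiple has been subtracted:
  \<open>sub_entry X 1 = 0\<close> is a third zero of the quadratic b, so b vanishes and the
  diagonal is constant.\<close>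

lemma band_cov_commutant_scalar:
  fixes X :: "'n::{finite,linorder} sqmat"
  assumes W: "0 < W" "W < 1/2" and N: "CARD('n) \<ge> 2"
    and X: "X \<in> sym_tridiagonals" and comm: "commutator (band_cov W) X = 0"
    and sub1: "sub_entry X 1 = 0"
  shows "X = diag_entry X 0 *\<^sub>R mat 1"
proof -
  define t where "t = 2 * pi * W"
  define c where "c = cos t"
  have t: "0 < t" "t < pi" using W by (auto simp: t_def)
  then have sin_pos: "sin t > 0" by (rule sin_gt_zero)
  \<comment> \<open>The kernel values at 1, 2 and 3 are sin t / pi times 1, c and (4c^2 - 1)/3. The
    common factor is nonzero and cancels from both subdiagonal equations.\<close>
  have r1: "sinc_kernel W 1 = sin t / pi" by (simp add: sinc_kernel_def t_def)
  have r2: "sinc_kernel W 2 = sin t * c / pi"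
    using sin_double[of t] by (simp add: sinc_kernel_def t_def c_def mult_ac)
  have s2: "(sin t)\<^sup>2 = 1 - c\<^sup>2" unfolding c_def by (simp add: sin_squared_eq)
  then have c2: "1 - c\<^sup>2 > 0" using sin_pos by (metis zero_less_power)
  have "sin (3 * t) = sin (2 * t + t)" by simp
  also have "\<dots> = 2 * sin t * c * c + (2 * c\<^sup>2 - 1) * sin t"
    by (simp only: sin_add sin_double cos_double_cos c_def)
  finally have "sin (3 * t) = sin t * (4 * c\<^sup>2 - 1)" by (simp add: power2_eq_square algebra_simps)
  then have r3: "sinc_kernel W 3 = sin t * ((4 * c\<^sup>2 - 1) / 3) / pi"
    by (simp add: sinc_kernel_def t_def mult_ac)
  define a b where "a = diag_entry X" and "b = sub_entry X"
  have entry: "sinc_kernel W (real m - real n) * (a n - a m)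
     + sinc_kernel W (real m - real n + 1) * (b n - b (Suc m))
     + sinc_kernel W (real m - real n - 1) * (b (Suc n) - b m) = 0"
    if "m < CARD('n)" "n < CARD('n)" for m n
    using commutator_band_cov[OF X, of W "nth_index m" "nth_index n"] that comm
    by (simp add: a_def b_def)
  \<comment> \<open>Entry (n + 1, n). The kernel value at 0 is multiplied by b(n + 1) - b(n + 1) and
    drops out.\<close>
  have step1: "a n - a (n + 1) = - (c * (b n - b (n + 2)))" if "n + 1 < CARD('n)" for n
  proof -
    have "sinc_kernel W 1 * (a n - a (n + 1)) + sinc_kernel W 2 * (b n - b (n + 2)) = 0"
      using entry[of "n + 1" n] that by simp
    then have "sin t / pi * (a n - a (n + 1) + c * (b n - b (n + 2))) = 0"
      unfolding r1 r2 by (simp add: algebra_simps)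
    then show ?thesis using sin_pos by simp
  qed
  \<comment> \<open>Entry (n + 2, n). Replacing the difference of a by two instances of
    \<open>step1\<close> leaves (1 - c^2)/3 times the third difference of b. The bound includes n +
    3 = N, where b takes its boundary value 0.\<close>
  have step2: "b (n + 3) - 3 * b (n + 2) + 3 * b (n + 1) - b n = 0" if "n + 3 \<le> CARD('n)" for n
  proof -
    have "sinc_kernel W 2 * (a n - a (n + 2)) + sinc_kernel W 3 * (b n - b (n + 3))
        + sinc_kernel W 1 * (b (n + 1) - b (n + 2)) = 0"
      using entry[of "n + 2" n] that by (simp add: numeral_3_eq_3)
    moreover have "sinc_kernel W 2 * u + sinc_kernel W 3 * v + sinc_kernel W 1 * w
        = sin t / pi * (c * u + (4 * c\<^sup>2 - 1) / 3 * v + w)" for u v w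
      unfolding r1 r2 r3 by (simp add: field_simps)
    ultimately have "sin t / pi * (c * (a n - a (n + 2)) + (4 * c\<^sup>2 - 1) / 3 * (b n - b (n + 3))
        + (b (n + 1) - b (n + 2))) = 0"
      by simp
    then have "c * (a n - a (n + 2)) + (4 * c\<^sup>2 - 1) / 3 * (b n - b (n + 3))
        + (b (n + 1) - b (n + 2)) = 0"
      using sin_pos by simp
    moreover have diff: "a n - a (n + 2) = - (c * (b n - b (n + 2))) - c * (b (n + 1) - b (n + 3))"
      using step1[of n] step1[of "n + 1"] that by (simp add: numeral_3_eq_3)
    ultimately have "(1 - c\<^sup>2) * (b (n + 3) - 3 * b (n + 2) + 3 * b (n + 1) - b n) = 0"
      unfolding diff by (simp add: power2_eq_square field_simps)
    then show ?thesis using c2 by simp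
  qed
  have b0: "b k = 0" if "k \<le> CARD('n)" for k
    by (rule third_difference_zero[of "CARD('n)" b]) (use step2 N sub1 that in \<open>simp_all add: b_def\<close>)
  have a0: "a k = a 0" if "k < CARD('n)" for k
    using that
  proof (induction k)
    case (Suc k)
    then show ?case using step1[of k] b0[of k] b0[of "k + 2"] by simp
  qed simp
  have "X $ i $ j = (diag_entry X 0 *\<^sub>R mat 1 :: 'n sqmat) $ i $ j" for i j
    using sym_tridiagonal_entry[OF X, of i j] a0[of "idx j"] b0[of "idx i"] b0[of "idx j"]
      idx_less_CARD[of i] idx_less_CARD[of j]
    by (auto simp: a_def b_def mat_def)
  then show ?thesis by (simp add: vec_eq_iff)
qed

lemma kernel_commutator_band_cov:
  assumes W: "0 < W" "W < 1/2" and N: "CARD('n) \<ge> 2"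
  shows "{X \<in> sym_tridiagonals. commutator (band_cov W) X = 0}
     = span {mat 1, slepian W :: 'n::{finite,linorder} sqmat}" (is "?K = _")
proof
  have K: "subspace ?K"
    using subspace_sym_tridiagonals linear_commutator[of "band_cov W :: 'n sqmat"]
    by (auto simp: subspace_def linear_0 linear_add linear_scale)
  have "mat 1 \<in> (sym_tridiagonals :: 'n sqmat set)"
    by (auto simp: sym_tridiagonals_def symmetric_mat_def tridiagonal_def mat_def transpose_def vec_eq_iff)
  then show "span {mat 1, slepian W :: 'n sqmat} \<subseteq> ?K"
    by (intro span_minimal K)
      (auto simp: commutator_mat_1 commutator_slepian slepian_sym_tridiagonal)
  show "?K \<subseteq> span {mat 1, slepian W :: 'n sqmat}"
  proof
    fix X :: "'n sqmat" assume X: "X \<in> ?K"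
    let ?T = "slepian W :: 'n sqmat"
    have T: "sub_entry ?T 1 \<noteq> 0" using N by (simp add: sub_entry_slepian)
    \<comment> \<open>This multiple clears the first off-diagonal entry of X; the divisor is (N -
      1)/2, nonzero because N is at least 2.\<close>
    define k where "k = sub_entry X 1 / sub_entry ?T 1"
    define Y where "Y = X - k *\<^sub>R ?T"
    have "?T \<in> ?K" by (simp add: commutator_slepian slepian_sym_tridiagonal)
    then have Y: "Y \<in> ?K" unfolding Y_def using X K by (intro subspace_diff subspace_scale) auto
    have "sub_entry Y 1 = sub_entry X 1 - k * sub_entry ?T 1"
      by (simp add: sub_entry_def Y_def)
    then have "sub_entry Y 1 = 0" using T by (simp add: k_def)
    with Y have "Y = diag_entry Y 0 *\<^sub>R mat 1"
      by (intro band_cov_commutant_scalar[OF W N]) auto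
    then have "X = diag_entry Y 0 *\<^sub>R mat 1 + k *\<^sub>R ?T"
      by (simp add: Y_def algebra_simps)
    also have "\<dots> \<in> span {mat 1, ?T}"
      by (intro span_add span_scale span_base) auto
    finally show "X \<in> span {mat 1, ?T}" .
  qed
qed

text \<open>The Slepian matrix has a nonzero first off-diagonal entry while scalar matrices have
  none, so the two generators are independent.\<close>

lemma dim_span_mat_1_slepian:
  assumes N: "CARD('n) \<ge> 2"
  shows "dim (span {mat 1, slepian W :: 'n::{finite,linorder} sqmat}) = 2"
proof -
  let ?T = "slepian W :: 'n sqmat"
  have T: "sub_entry ?T 1 \<noteq> 0" using N by (simp add: sub_entry_slepian)
  have I: "sub_entry (c *\<^sub>R mat 1 :: 'n sqmat) 1 = 0" for c
    using idx_nth_index[of 0, where 'n='n] idx_nth_index[of 1, where 'n='n] N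
    by (auto simp: sub_entry_def mat_def simp del: idx_nth_index)
  have "?T \<notin> span {mat 1}" using T I by (auto simp: span_singleton)
  moreover have "(mat 1 :: 'n sqmat) \<noteq> 0" by (simp add: mat_def vec_eq_iff)
  ultimately have ind: "independent {?T, mat 1}" by (simp add: independent_insert)
  moreover have "?T \<noteq> mat 1" using T I[of 1] by auto
  ultimately show ?thesis using dim_span_eq_card_independent[OF ind] by (simp add: insert_commute)
qed

subsection \<open>Blocks of the second-order equation\<close>

lemma block_matrix_mult:
  "block a b (A ** B) = (\<Sum>c\<in>UNIV. block a c A ** block c b B)"
proof -
  have "block a b (A ** B) $ i $ j = (\<Sum>c\<in>UNIV. block a c A ** block c b B) $ i $ j" for i j
  proof -
    have "block a b (A ** B) $ i $ j
        = (\<Sum>p\<in>UNIV \<times> UNIV. A $ (a, i) $ p * B $ p $ (b, j))"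
      by (simp add: block_def matrix_matrix_mult_def)
    also have "\<dots> = (\<Sum>c\<in>UNIV. \<Sum>k\<in>UNIV. A $ (a, i) $ (c, k) * B $ (c, k) $ (b, j))"
      unfolding sum.cartesian_product by (rule sum.cong) auto
    also have "\<dots> = (\<Sum>c\<in>UNIV. block a c A ** block c b B) $ i $ j"
      by (simp add: block_def matrix_matrix_mult_def)
    finally show ?thesis .
  qed
  then show ?thesis unfolding vec_eq_iff by blast
qed

lemma block_2_matrix_mult:
  fixes A B :: "(2 \<times> 'n::finite) sqmat"
  shows "block a b (A ** B) = block a 1 A ** block 1 b B + block a 2 A ** block 2 b B"
  by (simp add: block_matrix_mult sum_2)

lemma block_linear:
  "block a b (A + B) = block a b A + block a b B"
  "block a b (A - B) = block a b A - block a b B"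
  "block a b (c *\<^sub>R A) = c *\<^sub>R block a b A"
  "block a b (0 :: ('a::finite \<times> 'b::finite) sqmat) = 0"
  by (simp_all add: block_def vec_eq_iff)

lemma block_diag2:
  "block 1 1 (diag2 A B) = A" "block 1 2 (diag2 A B) = 0"
  "block 2 1 (diag2 A B) = 0" "block 2 2 (diag2 A B) = B"
  by (simp_all add: block_def diag2_def kron_def mat_unit_def vec_eq_iff)

lemma block_offdiag2:
  "block 1 1 (offdiag2 S) = 0" "block 1 2 (offdiag2 S) = S"
  "block 2 1 (offdiag2 S) = transpose S" "block 2 2 (offdiag2 S) = 0"
  by (simp_all add: block_def offdiag2_def kron_def mat_unit_def vec_eq_iff)

lemma eq_0_iff_blocks:
  fixes M :: "(2 \<times> 'n::finite) sqmat"
  shows "M = 0 \<longleftrightarrow> block 1 1 M = 0 \<and> block 1 2 M = 0 \<and> block 2 1 M = 0 \<and> block 2 2 M = 0"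
  by (auto simp: block_def vec_eq_iff forall_2)

lemma block_transpose: "block a b (transpose M) = transpose (block b a M)"
  by (simp add: block_def transpose_def)

lemma matrix_mult_zero [simp]: "(A :: real^'n^'m) ** 0 = 0" "0 ** (B :: real^'m^'n) = 0"
  by (simp_all add: matrix_matrix_mult_def vec_eq_iff)

lemmas block_simps = commutator_def block_linear block_2_matrix_mult block_diag2 block_offdiag2

text \<open>\<open>T0\<close> is block diagonal, so a diagonal block of its commutator with
  \<open>Rdd\<close> involves only the same diagonal block of \<open>Rdd\<close>, which is 0. The
  product of two off-diagonal matrices is block diagonal and gives the inhomogeneous term.\<close>

lemma block_second_order_lhs:
  assumes "block 1 1 Rdd = 0" "block 2 2 Rdd = 0"
  shows "block 1 1 (second_order_lhs (diag2 R1 R2) (diag2 T1 T2) S \<tau> Rdd Tdd)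
      = commutator R1 (block 1 1 Tdd) + 2 *\<^sub>R (S ** transpose \<tau> - \<tau> ** transpose S)"
    and "block 2 2 (second_order_lhs (diag2 R1 R2) (diag2 T1 T2) S \<tau> Rdd Tdd)
      = commutator R2 (block 2 2 Tdd) + 2 *\<^sub>R (transpose S ** \<tau> - transpose \<tau> ** S)"
  using assms by (simp_all add: second_order_lhs_def block_simps)

lemma second_order_admissible_diag_blocks:
  assumes "second_order_admissible Rdd Tdd"
  shows "block a a Tdd \<in> sym_tridiagonals"
  using assms block_transpose[of a a Tdd]
  by (auto simp: second_order_admissible_def sym_tridiagonals_def symmetric_mat_def)

lemma subspace_comm_image: "subspace (comm_image R)"
  unfolding comm_image_def by (intro linear_subspace_image linear_commutator subspace_sym_tridiagonals)

text \<open>The two diagonal blocks are independent solvability conditions, one per channel. The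
  off-diagonal blocks carry no inhomogeneous term and impose no further obstruction.\<close>

lemma extends_to_second_order_iff:
  fixes R1 R2 T1 T2 S \<tau> :: "'n::{finite,linorder} sqmat"
  shows "extends_to_second_order (diag2 R1 R2) (diag2 T1 T2) S \<tau> \<longleftrightarrow>
    S ** transpose \<tau> - \<tau> ** transpose S \<in> comm_image R1 \<and>
    transpose S ** \<tau> - transpose \<tau> ** S \<in> comm_image R2"
    (is "_ \<longleftrightarrow> ?A1 \<in> _ \<and> ?A2 \<in> _")
proof
  assume "extends_to_second_order (diag2 R1 R2) (diag2 T1 T2) S \<tau>"
  then obtain Rdd Tdd where adm: "second_order_admissible Rdd Tdd"
    and eq: "second_order_lhs (diag2 R1 R2) (diag2 T1 T2) S \<tau> Rdd Tdd = 0"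
    unfolding extends_to_second_order_def by blast
  \<comment> \<open>The image is a subspace, so the factor -2 between the commutator and
    \<open>A\<close> is harmless.\<close>
  have half: "A \<in> comm_image R"
    if "commutator R X + 2 *\<^sub>R A = 0" "X \<in> sym_tridiagonals" for R X A :: "'n sqmat"
  proof -
    have "commutator R X \<in> comm_image R" using that(2) by (simp add: comm_image_def)
    moreover have "A = (- 1/2) *\<^sub>R commutator R X"
      using that(1) by (simp add: eq_neg_iff_add_eq_0[symmetric])
    ultimately show ?thesis using subspace_comm_image by (metis subspace_scale)
  qed
  have "block 1 1 Rdd = 0" "block 2 2 Rdd = 0"
    using adm by (simp_all add: second_order_admissible_def)
  note blocks = block_second_order_lhs[OF this, of R1 R2 T1 T2 S \<tau> Tdd]
  show "?A1 \<in> comm_image R1 \<and> ?A2 \<in> comm_image R2"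
    using half[of R1 "block 1 1 Tdd" ?A1] half[of R2 "block 2 2 Tdd" ?A2] blocks
      second_order_admissible_diag_blocks[OF adm]
    by (simp add: eq block_linear)
next
  assume "?A1 \<in> comm_image R1 \<and> ?A2 \<in> comm_image R2"
  then obtain X1 X2 where X: "X1 \<in> sym_tridiagonals" "X2 \<in> sym_tridiagonals"
    and A: "?A1 = commutator R1 X1" "?A2 = commutator R2 X2"
    by (auto simp: comm_image_def)
  \<comment> \<open>The scaling by -2 cancels the factor 2 of the first-order commutator;
    \<open>Rdd\<close> is taken to be 0.\<close>
  define Tdd where "Tdd = diag2 ((- 2) *\<^sub>R X1) ((- 2) *\<^sub>R X2)"
  have X': "(- 2) *\<^sub>R X1 \<in> sym_tridiagonals" "(- 2) *\<^sub>R X2 \<in> sym_tridiagonals"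
    using X subspace_sym_tridiagonals subspace_scale by blast+
  have "transpose Tdd - Tdd = 0"
    unfolding eq_0_iff_blocks[of "transpose Tdd - Tdd"] using X'
    by (simp add: Tdd_def block_linear block_transpose block_diag2 sym_tridiagonals_def
        symmetric_mat_def del: scaleR_minus_left)
  moreover have "\<forall>a b. tridiagonal (block a b Tdd)"
    unfolding forall_2 using X'
    by (auto simp: Tdd_def block_diag2 sym_tridiagonals_def) (auto simp: tridiagonal_def)
  ultimately have "second_order_admissible 0 Tdd"
    by (simp add: second_order_admissible_def symmetric_mat_def block_linear)
  moreover have "second_order_lhs (diag2 R1 R2) (diag2 T1 T2) S \<tau> 0 Tdd = 0"
  proof -
    have cancel: "commutator R ((- 2) *\<^sub>R X) + 2 *\<^sub>R commutator R X = 0" for R X :: "'n sqmat"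
      by (simp only: linear_scale[OF linear_commutator] flip: scaleR_left_distrib) simp
    have "block 1 1 (second_order_lhs (diag2 R1 R2) (diag2 T1 T2) S \<tau> 0 Tdd) = 0"
      "block 2 2 (second_order_lhs (diag2 R1 R2) (diag2 T1 T2) S \<tau> 0 Tdd) = 0"
      using block_second_order_lhs[of 0 R1 R2 T1 T2 S \<tau> Tdd]
      unfolding A by (simp_all only: block_linear Tdd_def block_diag2 cancel)
    \<comment> \<open>In the off-diagonal blocks every term vanishes: \<open>R0\<close> and
      \<open>Tdd\<close> are block diagonal, and so is the commutator of the two off-diagonal
      first-order matrices.\<close>
    then show ?thesis
      unfolding eq_0_iff_blocks[of "second_order_lhs _ _ _ _ _ _"]
      by (simp add: second_order_lhs_def Tdd_def block_simps)
  qed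
  ultimately show "extends_to_second_order (diag2 R1 R2) (diag2 T1 T2) S \<tau>"
    unfolding extends_to_second_order_def by blast
qed


section \<open>Image and cokernel in one channel, and the theorem\<close>

lemma comm_image_band_cov:
  assumes W: "0 < W" "W < 1/2" and N: "CARD('n) \<ge> 2"
  defines "R \<equiv> band_cov W :: 'n::{finite,linorder} sqmat"
  shows "comm_image R \<subseteq> antisymmetric_mats"
    and "dim (comm_image R) = 2 * CARD('n) - 3"
    and "has_quotient_dim antisymmetric_mats (comm_image R)
          ((CARD('n) choose 2) - (2 * CARD('n) - 3))"
proof -
  have "transpose R = R"
    by (auto simp: R_def band_cov_entry transpose_def vec_eq_iff)
      (metis minus_diff_eq sinc_kernel_minus)
  then show sub: "comm_image R \<subseteq> antisymmetric_mats"
    by (auto simp: comm_image_def antisymmetric_mats_def sym_tridiagonals_def symmetric_mat_def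
        commutator_def transpose_diff matrix_transpose_mul)
  \<comment> \<open>Rank-nullity with a kernel of dimension 2 in a space of dimension 2N -
    1.\<close>
  have "dim (comm_image R) + 2 = 2 * CARD('n) - 1"
    using dim_linear_image_kernel[OF linear_commutator[of R] subspace_sym_tridiagonals]
      kernel_commutator_band_cov[OF W N] dim_span_mat_1_slepian[OF N, of W]
    by (simp add: R_def comm_image_def dim_sym_tridiagonals del: dim_span)
  then show dim: "dim (comm_image R) = 2 * CARD('n) - 3" by simp
  \<comment> \<open>No subtraction truncates here: 2N - 3 is positive for N >= 2, and the cokernel
    dimension equals (N - 2)(N - 3)/2.\<close>
  show "has_quotient_dim antisymmetric_mats (comm_image R)
      ((CARD('n) choose 2) - (2 * CARD('n) - 3))"
    using has_quotient_dim_subspace[OF subspace_comm_image subspace_antisymmetric_mats sub]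
    unfolding dim dim_antisymmetric_mats .
qed

theorem lemma12p5:
  fixes W1 W2 :: real
    and R1 R2 T1 T2 :: "'n::{finite,linorder} sqmat"
    and R0 T0 :: "(2 \<times> 'n) sqmat"
  assumes "CARD('n) \<ge> 2"
    and "0 < W1" "W1 < 1/2" "0 < W2" "W2 < 1/2" "W1 \<noteq> W2"
    and "R1 = band_cov W1" "R2 = band_cov W2"
    and "T1 = slepian W1" "T2 = slepian W2"
    and "R0 = diag2 R1 R2" "T0 = diag2 T1 T2"
  shows
    "(\<forall>(R, T) \<in> {(R1, T1), (R2, T2)}.
        {X \<in> sym_tridiagonals. commutator R X = 0} = span {mat 1, T} \<and>
        subspace (comm_image R) \<and>
        comm_image R \<subseteq> antisymmetric_mats \<and>
        dim (comm_image R) = 2 * CARD('n) - 3 \<and>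
        has_quotient_dim antisymmetric_mats (comm_image R)
          ((CARD('n) choose 2) - (2 * CARD('n) - 3))) \<and>
     (\<forall>S \<tau>. first_order_coupling R0 T0 S \<tau> \<longrightarrow>
        (let A1 = S ** transpose \<tau> - \<tau> ** transpose S;
             A2 = transpose S ** \<tau> - transpose \<tau> ** S
         in
          (\<forall>Rdd Tdd. second_order_admissible Rdd Tdd \<longrightarrow>
             block 1 1 Tdd \<in> sym_tridiagonals \<and>
             block 2 2 Tdd \<in> sym_tridiagonals \<and>
             (block 1 1 (second_order_lhs R0 T0 S \<tau> Rdd Tdd) = 0 \<longleftrightarrow>
                commutator R1 (block 1 1 Tdd) = - (2 *\<^sub>R A1)) \<and>
             (block 2 2 (second_order_lhs R0 T0 S \<tau> Rdd Tdd) = 0 \<longleftrightarrow>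
                commutator R2 (block 2 2 Tdd) = - (2 *\<^sub>R A2))) \<and>
          A1 \<in> antisymmetric_mats \<and> A2 \<in> antisymmetric_mats \<and>
          (extends_to_second_order R0 T0 S \<tau> \<longleftrightarrow>
             quot_proj antisymmetric_mats (comm_image R1) A1
               = quot_proj antisymmetric_mats (comm_image R1) 0 \<and>
             quot_proj antisymmetric_mats (comm_image R2) A2
               = quot_proj antisymmetric_mats (comm_image R2) 0) \<and>
          (extends_to_second_order R0 T0 S \<tau> \<longleftrightarrow>
             A1 \<in> comm_image R1 \<and> A2 \<in> comm_image R2)))"

proof -
  have channel: "{X \<in> sym_tridiagonals. commutator R X = 0} = span {mat 1, T} \<and>
        subspace (comm_image R) \<and>
        comm_image R \<subseteq> antisymmetric_mats \<and>
        dim (comm_image R) = 2 * CARD('n) - 3 \<and>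
        has_quotient_dim antisymmetric_mats (comm_image R)
          ((CARD('n) choose 2) - (2 * CARD('n) - 3))"
    if "(R, T) \<in> {(R1, T1), (R2, T2)}" for R T
  proof -
    obtain W where W: "0 < W" "W < 1/2" and "R = band_cov W" "T = slepian W"
      using \<open>(R, T) \<in> _\<close> assms by auto
    then show ?thesis
      using kernel_commutator_band_cov[OF W] comm_image_band_cov[OF W] subspace_comm_image
        \<open>CARD('n) \<ge> 2\<close> by blast
  qed
  have anti: "S ** transpose \<tau> - \<tau> ** transpose S \<in> antisymmetric_mats"
    "transpose S ** \<tau> - transpose \<tau> ** S \<in> antisymmetric_mats" for S \<tau> :: "'n sqmat"
    by (simp_all add: antisymmetric_mats_def transpose_diff matrix_transpose_mul)
  \<comment> \<open>Vanishing of the projection to the cokernel becomes membership in the image, so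
    the two forms of the extension criterion coincide.\<close>
  have quot: "quot_proj antisymmetric_mats (comm_image R) A
      = quot_proj antisymmetric_mats (comm_image R) 0 \<longleftrightarrow> A \<in> comm_image R"
    if "A \<in> antisymmetric_mats" for R A :: "'n sqmat"
    using quot_proj_eq_iff[OF subspace_comm_image that, of R 0] by simp
  have within: "(block 1 1 (second_order_lhs R0 T0 S \<tau> Rdd Tdd) = 0 \<longleftrightarrow>
        commutator R1 (block 1 1 Tdd) = - (2 *\<^sub>R (S ** transpose \<tau> - \<tau> ** transpose S))) \<and>
      (block 2 2 (second_order_lhs R0 T0 S \<tau> Rdd Tdd) = 0 \<longleftrightarrow>
        commutator R2 (block 2 2 Tdd) = - (2 *\<^sub>R (transpose S ** \<tau> - transpose \<tau> ** S)))"
    if "second_order_admissible Rdd Tdd" for S \<tau> Rdd Tdd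
    using that block_second_order_lhs[of Rdd R1 R2 T1 T2 S \<tau> Tdd]
    by (simp add: assms(11,12) second_order_admissible_def eq_neg_iff_add_eq_0)
  have extends: "extends_to_second_order R0 T0 S \<tau> \<longleftrightarrow>
      S ** transpose \<tau> - \<tau> ** transpose S \<in> comm_image R1 \<and>
      transpose S ** \<tau> - transpose \<tau> ** S \<in> comm_image R2" for S \<tau>
    unfolding assms(11,12) by (rule extends_to_second_order_iff)
  show ?thesis
    unfolding Let_def quot[OF anti(1)] quot[OF anti(2)]
  proof (rule conjI)
    show "\<forall>(R, T) \<in> {(R1, T1), (R2, T2)}.
        {X \<in> sym_tridiagonals. commutator R X = 0} = span {mat 1, T} \<and>
        subspace (comm_image R) \<and>
        comm_image R \<subseteq> antisymmetric_mats \<and>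
        dim (comm_image R) = 2 * CARD('n) - 3 \<and>
        has_quotient_dim antisymmetric_mats (comm_image R)
          ((CARD('n) choose 2) - (2 * CARD('n) - 3))"
      by (intro ballI, unfold split_paired_all prod.case) (rule channel)
  qed (intro allI impI conjI anti extends second_order_admissible_diag_blocks
      conjunct1[OF within] conjunct2[OF within]; assumption)
qed

end
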